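(* Let $s(q)\neq 0$. The sequences $$a=\left(L^*_{2n}(x,-s(q),q)\,s(q)^{-n}\right)_{n\ge 0},\qquad b=\left(\frac{x^{2n}}{s(q)^n\,(q;q)_{2n}}\right)_{n\ge 0}$$ form a Bailey pair with $m=0$, and the sequences $$a=\left(L^*_{2n+1}(x,-s(q),q)\,s(q)^{-n}\right)_{n\ge 0},\qquad b=\left(\frac{x^{2n+1}}{s(q)^n\,(q;q)_{2n+1}}\right)_{n\ge 0}$$ form a Bailey pair with $m=1$.
   Context: Here $x$ and $q$ are indeterminates and $s(q)$ is an arbitrary nonzero quantity, possibly depending on $q$ (e.g. a nonzero rational function of $q$). Write $(z;q)_n=\prod_{j=0}^{n-1}(1-q^jz)$, $\begin{bmatrix} n\\ k\end{bmatrix}=\dfrac{(q;q)_n}{(q;q)_k(q;q)_{n-k}}$ for $0\le k\le n$ (and $0$ otherwise), $[n]=\frac{1-q^n}{1-q}$. For $m\in\{0,1\}$, two sequences $a=(\alpha_n)_{n\ge0}$ and $b=(\beta_n)_{n\ge0}$ are called a Bailey pair (with parameter $m$) if for all $n\ge 0$ $$\beta_n=\sum_{k=0}^n\frac{\alpha_k}{(q;q)_{n-k}(q;q)_{n+k+m}}.$$ The classical Lucas polynomials are given by $L_0(x,s)=2$, $L_1(x,s)=x$, $L_n(x,s)=xL_{n-1}(x,s)+sL_{n-2}(x,s)$. Let $D$ be the $q$-differentiation operator $Df(x)=\dfrac{f(x)-f(qx)}{(1-q)x}$. The $q$-Lucas polynomials are $L_n(x,s,q)=L_n\big(x+(q-1)sD,s\big)1$,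 i.e. the operator obtained by substituting $x+(q-1)sD$ for $x$ (with $x$ acting as multiplication), applied to the constant polynomial $1$. Explicitly, for $n>0$, $$L_n(x,s,q)=\sum_{k=0}^{\lfloor n/2\rfloor} q^{\binom k2}\frac{[n]}{[n-k]}\begin{bmatrix} n-k\\ k\end{bmatrix}s^kx^{n-2k}.$$ Finally $L_n^*(x,s,q)=L_n(x,s,q)$ for $n>0$ and $L_0^*(x,s,q)=1$; $L^*_n(x,-s(q),q)$ means $s$ is replaced by $-s(q)$. *)

theory Defs
  imports "HOL-Computational_Algebra.Polynomial"
begin

definition qpoch :: "'a::comm_ring_1 \<Rightarrow> 'a \<Rightarrow> nat \<Rightarrow> 'a" where
  "qpoch z q n = (\<Prod>j<n. 1 - q ^ j * z)"

text \<open>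
  The ground field is \<^typ>\<open>'a\<close>, with \<open>q\<close> and \<open>s\<close> elements of it. That \<open>q\<close> is an indeterminate is
  expressed by requiring it to be transcendental over the rationals; \<open>s\<close> is any nonzero element of
  the field, for instance a rational function of \<open>q\<close>. The indeterminate \<open>x\<close> is the variable of
  \<^typ>\<open>'a poly\<close>. Dividing a polynomial in \<open>x\<close> by a nonzero scalar \<open>c\<close> is written
  \<open>smult (1 / c)\<close>.
\<close>

definition bailey_pair ::
    "'a::field \<Rightarrow> nat \<Rightarrow> (nat \<Rightarrow> 'a poly) \<Rightarrow> (nat \<Rightarrow> 'a poly) \<Rightarrow> bool" where
  "bailey_pair q m \<alpha> \<beta> \<longleftrightarrow>
     (\<forall>n. \<beta> n = (\<Sum>k\<le>n. smult (1 / (qpoch q q (n - k) * qpoch q q (n + k + m))) (\<alpha> k)))"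

fun lucas :: "nat \<Rightarrow> 'a::comm_ring_1 \<Rightarrow> 'a poly" where
  "lucas 0 s = 2"
| "lucas (Suc 0) s = [:0, 1:]"
| "lucas (Suc (Suc n)) s = [:0, 1:] * lucas (Suc n) s + smult s (lucas n s)"

text \<open>
  \<open>D f(x) = (f(x) - f(q x)) / ((1 - q) x)\<close>. The numerator has no constant term, so for \<open>q \<noteq> 1\<close> the
  polynomial division is exact.
\<close>

definition qderiv :: "'a::field \<Rightarrow> 'a poly \<Rightarrow> 'a poly" where
  "qderiv q f = (f - f \<circ>\<^sub>p [:0, q:]) div [:0, 1 - q:]"

text \<open>The operator \<open>p(T)\<close> obtained by substituting the linear operator \<open>T\<close> for the variable of \<open>p\<close>.\<close>

definition poly_operator :: "'a::field poly \<Rightarrow> ('a poly \<Rightarrow> 'a poly) \<Rightarrow> 'a poly \<Rightarrow> 'a poly" where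
  "poly_operator p T f = (\<Sum>i\<le>degree p. smult (coeff p i) ((T ^^ i) f))"

text \<open>\<open>L\<^sub>n(x, s, q) = L\<^sub>n(x + (q - 1) s D, s) 1\<close>\<close>

definition qlucas :: "nat \<Rightarrow> 'a::field \<Rightarrow> 'a \<Rightarrow> 'a poly" where
  "qlucas n s q =
     poly_operator (lucas n s) (\<lambda>f. [:0, 1:] * f + smult ((q - 1) * s) (qderiv q f)) 1"

definition qlucas_star :: "nat \<Rightarrow> 'a::field \<Rightarrow> 'a \<Rightarrow> 'a poly" where
  "qlucas_star n s q = (if n = 0 then 1 else qlucas n s q)"

end

theory Submission
  imports Defs
begin

text \<open>
  Write \<open>T = x + (1 - q) s D\<close>, so that \<open>L\<^sub>n(x, -s, q) = L\<^sub>n(T, -s) 1\<close>. Both claims amount to the expansion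
  of \<open>x\<^sup>N\<close> as the sum over \<open>j \<le> N / 2\<close> of \<open>[N choose j] s\<^sup>j L\<^sup>*(x, -s, q)\<close> with \<open>L\<^sup>*\<close> of index \<open>N - 2 j\<close>.
  Formally \<open>T = A + s / A\<close> and \<open>L\<^sub>n(T, -s) = A\<^sup>n + (s / A)\<^sup>n\<close>, so twice the right-hand side is the
  Rogers-Szegoe polynomial \<open>H\<^sub>N(A, s / A)\<close> applied to 1, up to the factor 2 coming from \<open>L\<^sub>0 = 2\<close>. Its
  recurrence \<open>H\<^sub>N\<^sub>+\<^sub>1 = T H\<^sub>N - s (1 - q\<^sup>N) H\<^sub>N\<^sub>-\<^sub>1\<close> is also satisfied by \<open>x\<^sup>N\<close>.
\<close>

section \<open>Nonvanishing of the q-shifted factorials\<close>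

text \<open>Makes all denominators \<open>qpoch q q n\<close> nonzero and yields
  \<open>q \<noteq> 1\<close>.\<close>

lemma not_algebraic_power_neq_1:
  fixes q :: "'a::field_char_0"
  assumes "\<not> algebraic q" "n > 0"
  shows "q ^ n \<noteq> 1"
proof
  assume "q ^ n = 1"
  then have "poly (monom 1 n - 1) q = 0"
    by (simp add: poly_monom)
  moreover have "monom 1 n - 1 \<noteq> (0 :: 'a poly)"
  proof
    assume "monom 1 n - 1 = (0 :: 'a poly)"
    then have "coeff (monom 1 n - 1 :: 'a poly) n = 0" by simp
    with assms(2) show False by simp
  qed
  moreover have "\<forall>i. coeff (monom 1 n - 1 :: 'a poly) i \<in> \<int>"
    by (auto simp: coeff_monom coeff_1)
  ultimately show False
    using assms(1) unfolding algebraic_def by blast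
qed

lemma qpoch_0 [simp]: "qpoch z q 0 = 1"
  by (simp add: qpoch_def)

lemma qpoch_Suc: "qpoch q q (Suc n) = qpoch q q n * (1 - q ^ Suc n)"
  by (simp add: qpoch_def mult.commute)

lemma qpoch_neq_0:
  fixes q :: "'a::field_char_0"
  assumes "\<not> algebraic q"
  shows "qpoch q q n \<noteq> 0"
proof (induction n)
  case (Suc n)
  then show ?case
    using not_algebraic_power_neq_1[OF assms, of "Suc n"] by (simp add: qpoch_Suc del: power_Suc)
qed simp

section \<open>Polynomials evaluated at an operator\<close>

lemma smult_sum_right: "smult c (sum f A) = (\<Sum>i\<in>A. smult c (f i))"
  by (induction A rule: infinite_finite_induct) (simp_all add: smult_add_right)

lemma poly_operator_eq_sum:
  assumes "degree p \<le> d"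
  shows "poly_operator p T f = (\<Sum>i\<le>d. smult (coeff p i) ((T ^^ i) f))"
  unfolding poly_operator_def
  by (rule sum.mono_neutral_left) (use assms in \<open>auto simp: coeff_eq_0 not_le\<close>)

lemma poly_operator_add:
  "poly_operator (p + r) T f = poly_operator p T f + poly_operator r T f"
proof -
  define d where "d = max (degree p) (degree r)"
  have "degree p \<le> d" "degree r \<le> d" "degree (p + r) \<le> d"
    by (auto simp: d_def intro: degree_add_le)
  then show ?thesis
    by (simp add: poly_operator_eq_sum smult_add_left sum.distrib)
qed

lemma poly_operator_smult:
  "poly_operator (smult c p) T f = smult c (poly_operator p T f)"
proof -
  have "degree (smult c p) \<le> degree p" by (rule degree_smult_le)
  then have "poly_operator (smult c p) T f =
      (\<Sum>i\<le>degree p. smult (coeff (smult c p) i) ((T ^^ i) f))"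
    by (rule poly_operator_eq_sum)
  also have "\<dots> = smult c (\<Sum>i\<le>degree p. smult (coeff p i) ((T ^^ i) f))"
    by (simp add: smult_sum_right)
  finally show ?thesis by (simp add: poly_operator_def)
qed

text \<open>The extra application of \<open>T\<close> lands on the argument \<open>f\<close>; for
  \<open>lucas_shift\<close> it is moved outside by
  \<open>poly_operator_lucas_shift\<close>.\<close>

lemma poly_operator_pCons:
  "poly_operator (pCons a p) T f = smult a f + poly_operator p T (T f)"
proof -
  have "degree (pCons a p) \<le> Suc (degree p)" by (rule degree_pCons_le)
  then have "poly_operator (pCons a p) T f =
      (\<Sum>i\<le>Suc (degree p). smult (coeff (pCons a p) i) ((T ^^ i) f))"
    by (rule poly_operator_eq_sum)
  also have "\<dots> = smult a f + poly_operator p T (T f)"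
    by (simp add: sum.atMost_Suc_shift poly_operator_def funpow_swap1 del: sum.atMost_Suc)
  finally show ?thesis .
qed

section \<open>The q-derivative and the operator T\<close>

lemma qderiv_add: "qderiv q (f + g) = qderiv q f + qderiv q g"
  by (simp add: qderiv_def pcompose_add add_diff_add poly_div_add_left)

lemma qderiv_smult: "qderiv q (smult c f) = smult c (qderiv q f)"
  by (simp add: qderiv_def pcompose_smult flip: smult_diff_right div_smult_left)

text \<open>Replacing x by q x scales a monomial, so the numerator of the q-derivative is again a
  monomial. Clearing the denominator \<open>1 - q\<close> matches the factor
  \<open>(1 - q) * s\<close> in T.\<close>

lemma qderiv_power:
  fixes q :: "'a::field"
  assumes "q \<noteq> 1"
  shows "smult (1 - q) (qderiv q ([:0, 1:] ^ Suc n)) = smult (1 - q ^ Suc n) ([:0, 1:] ^ n)"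
proof -
  have pw: "[:0, c:] ^ k = smult (c ^ k) ([:0, 1:] ^ k)" for c :: 'a and k
  proof -
    have "[:0, c:] = smult c [:0, 1:]" by simp
    then show ?thesis by (metis smult_power)
  qed
  have comp: "([:0, 1:] ^ k) \<circ>\<^sub>p [:0, q:] = [:0, q:] ^ k" for k
    by (induction k) (simp_all add: pcompose_1 pcompose_mult pcompose_pCons)
  have "([:0, 1:] :: 'a poly) ^ Suc n - ([:0, 1:] ^ Suc n) \<circ>\<^sub>p [:0, q:] =
      smult (1 - q ^ Suc n) ([:0, 1:] * [:0, 1:] ^ n)"
    unfolding comp pw[of q] by (simp add: smult_diff_left)
  \<comment> \<open>The numerator is exhibited as a multiple of the divisor, so that
    \<open>div\<close> cancels exactly.\<close>
  also have "\<dots> = [:0, 1 - q:] * smult ((1 - q ^ Suc n) / (1 - q)) ([:0, 1:] ^ n)"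
    using assms by (simp add: pw[of "1 - q" 1, simplified] del: power_Suc)
  finally have diff: "([:0, 1:] :: 'a poly) ^ Suc n - ([:0, 1:] ^ Suc n) \<circ>\<^sub>p [:0, q:] = \<dots>" .
  have "qderiv q ([:0, 1:] ^ Suc n) = smult ((1 - q ^ Suc n) / (1 - q)) ([:0, 1:] ^ n)"
    unfolding qderiv_def diff by (rule nonzero_mult_div_cancel_left) (use assms in simp)
  then show ?thesis using assms by simp
qed

text \<open>This is T: the operator inside \<open>qlucas\<close> with \<open>s\<close> replaced by
  \<open>- s\<close>, which turns \<open>q - 1\<close> into \<open>1 - q\<close>.\<close>

definition lucas_shift :: "'a::field \<Rightarrow> 'a \<Rightarrow> 'a poly \<Rightarrow> 'a poly" where
  "lucas_shift q s f = [:0, 1:] * f + smult ((1 - q) * s) (qderiv q f)"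

lemma lucas_shift_add: "lucas_shift q s (f + g) = lucas_shift q s f + lucas_shift q s g"
  by (simp add: lucas_shift_def qderiv_add smult_add_right algebra_simps)

lemma lucas_shift_smult: "lucas_shift q s (smult c f) = smult c (lucas_shift q s f)"
  by (simp add: lucas_shift_def qderiv_smult smult_add_right mult.commute)

lemma lucas_shift_0 [simp]: "lucas_shift q s 0 = 0"
  using lucas_shift_smult[of q s 0 0] by simp

lemma lucas_shift_sum: "lucas_shift q s (sum f A) = (\<Sum>i\<in>A. lucas_shift q s (f i))"
  by (induction A rule: infinite_finite_induct) (simp_all add: lucas_shift_add)

lemma lucas_shift_1 [simp]: "lucas_shift q s 1 = [:0, 1:]"
  by (simp add: lucas_shift_def qderiv_def pcompose_1)

text \<open>Says that the powers of x satisfy the recurrence of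
  \<open>rogers_szego_rec\<close>.\<close>

lemma lucas_shift_power:
  assumes "q \<noteq> 1"
  shows "lucas_shift q s ([:0, 1:] ^ Suc n) =
    [:0, 1:] ^ Suc (Suc n) + smult (s * (1 - q ^ Suc n)) ([:0, 1:] ^ n)"
proof -
  have "smult ((1 - q) * s) (qderiv q ([:0, 1:] ^ Suc n)) =
      smult s (smult (1 - q) (qderiv q ([:0, 1:] ^ Suc n)))"
    by (simp add: mult.commute del: power_Suc)
  also have "\<dots> = smult (s * (1 - q ^ Suc n)) ([:0, 1:] ^ n)"
    using qderiv_power[OF assms] by (simp del: power_Suc)
  finally show ?thesis by (simp add: lucas_shift_def)
qed

section \<open>Three-term recurrence of the q-Lucas polynomials\<close>

lemma poly_operator_lucas_shift:
  "poly_operator p (lucas_shift q s) (lucas_shift q s f) =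
    lucas_shift q s (poly_operator p (lucas_shift q s) f)"
  by (simp add: poly_operator_def lucas_shift_sum lucas_shift_smult funpow_swap1)

lemma qlucas_eq: "qlucas n (- s) q = poly_operator (lucas n (- s)) (lucas_shift q s) 1"
proof -
  have "(\<lambda>f. [:0, 1:] * f + smult ((q - 1) * - s) (qderiv q f)) = lucas_shift q s"
    by (auto simp: lucas_shift_def algebra_simps)
  then show ?thesis by (simp only: qlucas_def)
qed

lemma qlucas_0: "qlucas 0 s q = 2"
  by (simp add: qlucas_def poly_operator_def numeral_poly)

lemma qlucas_1: "qlucas (Suc 0) (- s) q = [:0, 1:]"
  by (simp add: qlucas_eq poly_operator_pCons) (simp add: poly_operator_def)

text \<open>The classical Lucas recurrence evaluated at T: multiplication by the variable is
  \<open>pCons 0\<close>, which becomes one application of T.\<close>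

lemma lucas_shift_qlucas:
  "lucas_shift q s (qlucas (Suc n) (- s) q) =
    qlucas (Suc (Suc n)) (- s) q + smult s (qlucas n (- s) q)"
proof -
  have "lucas (Suc (Suc n)) (- s) = pCons 0 (lucas (Suc n) (- s)) + smult (- s) (lucas n (- s))"
    by simp
  then have "qlucas (Suc (Suc n)) (- s) q =
      lucas_shift q s (qlucas (Suc n) (- s) q) + smult (- s) (qlucas n (- s) q)"
    unfolding qlucas_eq
    by (simp only: poly_operator_add poly_operator_smult poly_operator_pCons
        poly_operator_lucas_shift) simp
  then show ?thesis by simp
qed

text \<open>
  In the formal notation of the introduction, this is \<open>A\<^sup>a (s / A)\<^sup>b + (s / A)\<^sup>a A\<^sup>b\<close> applied to 1.
\<close>

definition lucas_monom :: "'a::field \<Rightarrow> 'a \<Rightarrow> nat \<Rightarrow> nat \<Rightarrow> 'a poly" where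
  "lucas_monom q s a b = smult (s ^ min a b) (qlucas (max a b - min a b) (- s) q)"

lemma lucas_monom_commute: "lucas_monom q s a b = lucas_monom q s b a"
  by (simp add: lucas_monom_def min.commute max.commute)

lemma lucas_monom_Suc_Suc: "lucas_monom q s (Suc a) (Suc b) = smult s (lucas_monom q s a b)"
  by (simp add: lucas_monom_def)

text \<open>Formally, multiplying by T = A + s / A raises one of the two exponents. The induction
  strips common factors A (s / A) = s until one exponent is 0, where the Lucas recurrence
  applies.\<close>

lemma lucas_shift_lucas_monom:
  "lucas_shift q s (lucas_monom q s a b) = lucas_monom q s (Suc a) b + lucas_monom q s a (Suc b)"
proof (induction a arbitrary: b)
  case 0
  \<comment> \<open>For both exponents 0 the value L_0 = 2 is essential: T 2 is twice L_1.\<close>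
  have shift2: "lucas_shift q s 2 = [:0, 1:] + [:0, 1:]"
    using lucas_shift_add[of q s 1 1] by simp
  show ?case
    by (cases b)
      (simp_all add: lucas_monom_def qlucas_0 qlucas_1 shift2 lucas_shift_qlucas add.commute)
next
  case (Suc a)
  show ?case
  proof (cases b)
    case 0
    then show ?thesis
      by (simp add: lucas_monom_def lucas_shift_qlucas)
  next
    case (Suc b')
    then show ?thesis
      using Suc.IH[of b'] by (simp add: lucas_monom_Suc_Suc lucas_shift_smult smult_add_right)
  qed
qed

section \<open>Gaussian binomials and Rogers-Szegoe polynomials\<close>

definition gauss_binomial :: "'a::field \<Rightarrow> nat \<Rightarrow> nat \<Rightarrow> 'a" where
  "gauss_binomial q n k = qpoch q q n / (qpoch q q k * qpoch q q (n - k))"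

lemma gauss_binomial_0 [simp]:
  "\<not> algebraic q \<Longrightarrow> gauss_binomial (q :: 'a::field_char_0) n 0 = 1"
  by (simp add: gauss_binomial_def qpoch_neq_0)

lemma gauss_binomial_self [simp]:
  "\<not> algebraic q \<Longrightarrow> gauss_binomial (q :: 'a::field_char_0) n n = 1"
  by (simp add: gauss_binomial_def qpoch_neq_0)

lemma gauss_binomial_symmetric:
  "k \<le> n \<Longrightarrow> gauss_binomial q n (n - k) = gauss_binomial q n k"
  by (simp add: gauss_binomial_def mult.commute)

lemma gauss_binomial_rec:
  fixes q :: "'a::field_char_0"
  assumes q: "\<not> algebraic q" and "k \<le> n"
  shows "gauss_binomial q (Suc n) (Suc k) + gauss_binomial q (Suc n) k =
    gauss_binomial q (Suc (Suc n)) (Suc k) + (1 - q ^ Suc n) * gauss_binomial q n k"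
proof -
  obtain l where n: "n = k + l" using \<open>k \<le> n\<close> le_Suc_ex by blast
  have nz: "1 - q ^ Suc i \<noteq> 0" "qpoch q q i \<noteq> 0" for i
    using not_algebraic_power_neq_1[OF q, of "Suc i"] qpoch_neq_0[OF q] by auto
  have sub: "Suc n - Suc k = l" "Suc n - k = Suc l" "Suc (Suc n) - Suc k = Suc l" "n - k = l"
    using n by auto
  define P u v w where "P = qpoch q q n" and "u = 1 - q ^ Suc k" and "v = 1 - q ^ Suc l"
    and "w = 1 - q ^ Suc n"
  \<comment> \<open>With n = k + l this is (1 - u) (1 - v) = q^(n+2). Over a common denominator the
    claim becomes u + v = (u + v - u v) + u v.\<close>
  have uv: "1 - q ^ Suc (Suc n) = u + v - u * v"
    by (simp add: u_def v_def n power_add algebra_simps)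
  have nz': "u \<noteq> 0" "v \<noteq> 0" "qpoch q q k \<noteq> 0" "qpoch q q l \<noteq> 0"
    using nz by (auto simp: u_def v_def simp del: power_Suc)
  show ?thesis
    unfolding gauss_binomial_def sub
    unfolding qpoch_Suc uv
    unfolding P_def[symmetric] u_def[symmetric] v_def[symmetric] w_def[symmetric]
    using nz' by (simp add: field_simps)
qed

definition rogers_szego :: "'a::field \<Rightarrow> 'a \<Rightarrow> nat \<Rightarrow> 'a poly" where
  "rogers_szego q s n = (\<Sum>j\<le>n. smult (gauss_binomial q n j) (lucas_monom q s (n - j) j))"

text \<open>T splits each summand in two; \<open>gauss_binomial_rec\<close> recombines neighbouring
  coefficients, and the surplus terms contain a common factor A (s / A) = s.\<close>

lemma rogers_szego_rec:
  fixes q :: "'a::field_char_0"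
  assumes q: "\<not> algebraic q"
  shows "lucas_shift q s (rogers_szego q s (Suc n)) =
    rogers_szego q s (Suc (Suc n)) + smult (s * (1 - q ^ Suc n)) (rogers_szego q s n)"
proof -
  let ?g = "gauss_binomial q" and ?F = "lucas_monom q s"
  have "lucas_shift q s (rogers_szego q s (Suc n)) =
      (\<Sum>j\<le>Suc n. smult (?g (Suc n) j) (?F (Suc (Suc n - j)) j)) +
      (\<Sum>j\<le>Suc n. smult (?g (Suc n) j) (?F (Suc n - j) (Suc j)))"
    by (simp add: rogers_szego_def lucas_shift_sum lucas_shift_smult lucas_shift_lucas_monom
        smult_add_right sum.distrib del: sum.atMost_Suc)
  \<comment> \<open>The shift of \<open>j\<close> gives both sums the same polynomials; the two
    extreme terms are set apart.\<close>
  also have "(\<Sum>j\<le>Suc n. smult (?g (Suc n) j) (?F (Suc (Suc n - j)) j)) =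
      ?F (Suc (Suc n)) 0 + (\<Sum>j\<le>n. smult (?g (Suc n) (Suc j)) (?F (Suc n - j) (Suc j)))"
    using q by (subst sum.atMost_Suc_shift) (simp add: Suc_diff_le)
  also have "(\<Sum>j\<le>Suc n. smult (?g (Suc n) j) (?F (Suc n - j) (Suc j))) =
      (\<Sum>j\<le>n. smult (?g (Suc n) j) (?F (Suc n - j) (Suc j))) + ?F 0 (Suc (Suc n))"
    using q by simp
  finally have lhs: "lucas_shift q s (rogers_szego q s (Suc n)) =
      ?F (Suc (Suc n)) 0 + ?F 0 (Suc (Suc n)) +
      (\<Sum>j\<le>n. smult (?g (Suc n) (Suc j) + ?g (Suc n) j) (?F (Suc n - j) (Suc j)))"
    by (simp add: smult_add_left sum.distrib algebra_simps)
  have "rogers_szego q s (Suc (Suc n)) =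
      ?F (Suc (Suc n)) 0 +
      (\<Sum>j\<le>Suc n. smult (?g (Suc (Suc n)) (Suc j)) (?F (Suc n - j) (Suc j)))"
    unfolding rogers_szego_def using q by (subst sum.atMost_Suc_shift) simp
  also have "\<dots> = ?F (Suc (Suc n)) 0 + ?F 0 (Suc (Suc n)) +
      (\<Sum>j\<le>n. smult (?g (Suc (Suc n)) (Suc j)) (?F (Suc n - j) (Suc j)))"
    using q by simp
  finally have mid: "rogers_szego q s (Suc (Suc n)) = \<dots>" .
  have "smult (?g (Suc n) (Suc j) + ?g (Suc n) j) (?F (Suc n - j) (Suc j)) =
      smult (?g (Suc (Suc n)) (Suc j)) (?F (Suc n - j) (Suc j)) +
      smult (s * (1 - q ^ Suc n)) (smult (?g n j) (?F (n - j) j))" if "j \<le> n" for j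
    using that
    by (simp add: gauss_binomial_rec[OF q that] smult_add_left distrib_left Suc_diff_le
        lucas_monom_Suc_Suc mult_ac del: power_Suc)
  then have "(\<Sum>j\<le>n. smult (?g (Suc n) (Suc j) + ?g (Suc n) j) (?F (Suc n - j) (Suc j))) =
      (\<Sum>j\<le>n. smult (?g (Suc (Suc n)) (Suc j)) (?F (Suc n - j) (Suc j))) +
      (\<Sum>j\<le>n. smult (s * (1 - q ^ Suc n)) (smult (?g n j) (?F (n - j) j)))"
    by (simp add: sum.distrib del: power_Suc smult_smult)
  also have "(\<Sum>j\<le>n. smult (s * (1 - q ^ Suc n)) (smult (?g n j) (?F (n - j) j))) =
      smult (s * (1 - q ^ Suc n)) (rogers_szego q s n)"
    unfolding rogers_szego_def by (rule smult_sum_right[symmetric])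
  finally show ?thesis
    by (simp add: lhs mid del: power_Suc)
qed

text \<open>Both sides satisfy the same second-order recurrence, with initial values 2 and 2
  x.\<close>

lemma rogers_szego_eq:
  fixes q :: "'a::field_char_0"
  assumes q: "\<not> algebraic q"
  shows "rogers_szego q s n = smult 2 ([:0, 1:] ^ n)"
proof (induction n rule: less_induct)
  case (less n)
  have q1: "q \<noteq> 1" using not_algebraic_power_neq_1[OF q, of 1] by simp
  consider "n = 0" | "n = Suc 0" | m where "n = Suc (Suc m)"
    by (metis not0_implies_Suc)
  then show ?case
  proof cases
    case 1
    then show ?thesis
      using q by (simp add: rogers_szego_def lucas_monom_def qlucas_0 numeral_poly)
  next
    case 2
    then show ?thesis
      using q by (simp add: rogers_szego_def lucas_monom_def qlucas_1)
  next
    case 3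
    then show ?thesis
      using rogers_szego_rec[OF q, of s m] less.IH[of "Suc m"] less.IH[of m]
      by (simp add: lucas_shift_smult lucas_shift_power[OF q1] smult_add_right mult_ac
          del: power_Suc)
  qed
qed

section \<open>Expansion of the powers of x\<close>

lemma sum_symmetric_fold:
  fixes h g :: "nat \<Rightarrow> 'a::comm_monoid_add"
  assumes sym: "\<And>j. j \<le> n \<Longrightarrow> h (n - j) = h j"
    and half: "\<And>j. 2 * j < n \<Longrightarrow> g j = h j"
    and mid: "\<And>j. n = 2 * j \<Longrightarrow> h j = g j + g j"
  shows "(\<Sum>j\<le>n. h j) = (\<Sum>j\<le>n div 2. g j) + (\<Sum>j\<le>n div 2. g j)"
proof -
  \<comment> \<open>Indices below, at and above the middle; \<open>B\<close> is empty for odd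
    \<open>n\<close>, and reflection exchanges \<open>A\<close> and \<open>C\<close>.\<close>
  define A B C where "A = {j. 2 * j < n}" and "B = {j. 2 * j = n}" and "C = {j. j \<le> n \<and> n < 2 * j}"
  have fin: "finite A" "finite B" "finite C"
    by (rule finite_subset[of _ "{..n}"]; force simp: A_def B_def C_def)+
  have low: "{..n div 2} = A \<union> B" and all: "{..n} = A \<union> B \<union> C"
    by (auto simp: A_def B_def C_def)
  have disj: "A \<inter> B = {}" "(A \<union> B) \<inter> C = {}"
    by (auto simp: A_def B_def C_def)
  have "sum h C = sum g A"
    by (rule sum.reindex_bij_witness[of _ "\<lambda>j. n - j" "\<lambda>j. n - j"])
      (auto simp: A_def C_def half sym)
  moreover have "sum h A = sum g A"
    by (rule sum.cong) (auto simp: A_def half)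
  moreover have "sum h B = sum g B + sum g B"
    unfolding sum.distrib[symmetric] by (rule sum.cong) (auto simp: B_def mid)
  moreover have "sum h {..n} = sum h A + sum h B + sum h C" "sum g {..n div 2} = sum g A + sum g B"
    unfolding low all using fin disj by (simp_all only: sum.union_disjoint finite_Un)
  ultimately show ?thesis
    by (simp add: ac_simps)
qed

text \<open>Folding the symmetric sum \<open>rogers_szego\<close> pairs equal terms. The unpaired
  middle term for even \<open>n\<close> contains L_0 = 2, which is twice the starred value 1, so
  everything can be halved.\<close>

lemma power_eq_sum_qlucas_star:
  fixes q s :: "'a::field_char_0"
  assumes q: "\<not> algebraic q"
  shows "[:0, 1:] ^ n =
    (\<Sum>j\<le>n div 2. smult (gauss_binomial q n j * s ^ j) (qlucas_star (n - 2 * j) (- s) q))"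
    (is "_ = ?S")
proof -
  have "smult 2 ([:0, 1:] ^ n) = rogers_szego q s n"
    by (simp add: rogers_szego_eq[OF q])
  also have "\<dots> = ?S + ?S"
    unfolding rogers_szego_def
  proof (rule sum_symmetric_fold)
    fix j assume "j \<le> n"
    then show "smult (gauss_binomial q n (n - j)) (lucas_monom q s (n - (n - j)) (n - j)) =
        smult (gauss_binomial q n j) (lucas_monom q s (n - j) j)"
      by (simp add: gauss_binomial_symmetric lucas_monom_commute)
  next
    fix j assume "2 * j < n"
    then have "min (n - j) j = j" "max (n - j) j - min (n - j) j = n - 2 * j" "n - 2 * j \<noteq> 0"
      by auto
    then show "smult (gauss_binomial q n j * s ^ j) (qlucas_star (n - 2 * j) (- s) q) =
        smult (gauss_binomial q n j) (lucas_monom q s (n - j) j)"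
      by (simp add: lucas_monom_def qlucas_star_def)
  next
    fix j assume "n = 2 * j"
    then show "smult (gauss_binomial q n j) (lucas_monom q s (n - j) j) =
        smult (gauss_binomial q n j * s ^ j) (qlucas_star (n - 2 * j) (- s) q) +
        smult (gauss_binomial q n j * s ^ j) (qlucas_star (n - 2 * j) (- s) q)"
      by (simp add: lucas_monom_def qlucas_star_def qlucas_0 numeral_poly mult_ac)
  qed
  also have "\<dots> = smult 2 ?S"
    using smult_add_left[of 1 1 ?S] by simp
  finally have "smult (1 / 2) (smult 2 ([:0, 1:] ^ n)) = smult (1 / 2) (smult 2 ?S)"
    by (rule arg_cong)
  then show ?thesis by simp
qed

section \<open>The Bailey pairs\<close>

text \<open>Divide the expansion of x^N with N = 2 n + m by s^n (q;q)_N and put k = n - j: the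
  Gaussian binomial becomes the Bailey kernel, and s^(j - n) becomes s^(-k).\<close>

lemma bailey_pair_qlucas_star:
  fixes q s :: "'a::field_char_0"
  assumes q: "\<not> algebraic q" and s: "s \<noteq> 0" and m: "m \<le> 1"
  shows "bailey_pair q m
    (\<lambda>n. smult (1 / s ^ n) (qlucas_star (2 * n + m) (- s) q))
    (\<lambda>n. smult (1 / (s ^ n * qpoch q q (2 * n + m))) ([:0, 1:] ^ (2 * n + m)))"
  unfolding bailey_pair_def
proof
  fix n
  let ?N = "2 * n + m" and ?L = "\<lambda>k. qlucas_star k (- s) q"
  \<comment> \<open>The bound on \<open>m\<close> makes the expansion end exactly at
    \<open>j = n\<close>, that is, at \<open>k = 0\<close>.\<close>
  have "?N div 2 = n" using m by simp
  then have "smult (1 / (s ^ n * qpoch q q ?N)) ([:0, 1:] ^ ?N) =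
      (\<Sum>j\<le>n. smult (1 / (s ^ n * qpoch q q ?N))
        (smult (gauss_binomial q ?N j * s ^ j) (?L (?N - 2 * j))))"
    by (subst power_eq_sum_qlucas_star[OF q, of _ s]) (simp only: smult_sum_right)
  also have "\<dots> = (\<Sum>k\<le>n. smult (1 / (qpoch q q (n - k) * qpoch q q (n + k + m)))
      (smult (1 / s ^ k) (?L (2 * k + m))))"
  proof (rule sum.reindex_bij_witness[of _ "\<lambda>k. n - k" "\<lambda>j. n - j"])
    fix j assume "j \<in> {..n}"
    then obtain k where n: "n = j + k" using le_Suc_ex by auto
    have idx: "n - j = k" "n - k = j" "?N - 2 * j = 2 * k + m" "?N - j = n + k + m"
      using n by auto
    have "1 / (qpoch q q j * qpoch q q (n + k + m)) * (1 / s ^ k) =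
        1 / (s ^ n * qpoch q q ?N) * (gauss_binomial q ?N j * s ^ j)"
      unfolding gauss_binomial_def idx using s qpoch_neq_0[OF q]
      by (simp add: n power_add field_simps)
    then show "smult (1 / (qpoch q q (n - (n - j)) * qpoch q q (n + (n - j) + m)))
        (smult (1 / s ^ (n - j)) (?L (2 * (n - j) + m))) =
      smult (1 / (s ^ n * qpoch q q ?N))
        (smult (gauss_binomial q ?N j * s ^ j) (?L (?N - 2 * j)))"
      unfolding idx by simp
  qed auto
  finally show "smult (1 / (s ^ n * qpoch q q ?N)) ([:0, 1:] ^ ?N) = \<dots>" .
qed

theorem theorem5p1:
  fixes q s :: "'a::field_char_0"
  assumes "\<not> algebraic q" and "s \<noteq> 0"
  shows "bailey_pair q 0
           (\<lambda>n. smult (1 / s ^ n) (qlucas_star (2 * n) (- s) q))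
           (\<lambda>n. smult (1 / (s ^ n * qpoch q q (2 * n))) ([:0, 1:] ^ (2 * n)))
       \<and> bailey_pair q 1
           (\<lambda>n. smult (1 / s ^ n) (qlucas_star (2 * n + 1) (- s) q))
           (\<lambda>n. smult (1 / (s ^ n * qpoch q q (2 * n + 1))) ([:0, 1:] ^ (2 * n + 1)))"
  using bailey_pair_qlucas_star[OF assms, of 0] bailey_pair_qlucas_star[OF assms, of 1] by simp

end
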